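(* Let $H$ be a real Hilbert space, let $f, g \in \Gamma_0(H)$ and let $x \in \mathrm{D}(\mathrm{prox}^f_g)$ be fixed. Then, for any $y_0 \in H$, the sequence $(y_k)_{k \ge 0}$ defined by $$y_{k+1} = \overline{\mathcal{DR}}_{f,g}(x, y_k), \qquad k \ge 0,$$ weakly converges to an element $y^* \in \mathrm{prox}^f_g(x)$. Moreover, if $\mathrm{dom}(f) \cap \mathrm{dom}(g) \neq \emptyset$ and $\partial(f+g) = \partial f + \partial g$, then $\mathrm{prox}_f(y^* ) = \mathrm{prox}_{f+g}(x)$.
   Context: $\Gamma_0(H)$ is the set of proper, lower semicontinuous, convex functions $H \to \mathbb{R} \cup \{+\infty\}$. For $g : H \to \mathbb{R}\cup\{+\infty\}$, $\mathrm{dom}(g) = \{x \in H : g(x) < +\infty\}$. For $g \in \Gamma_0(H)$, the subdifferential is $\partial g(x) = \{ y \in H : \langle y, z-x\rangle \le g(z)-g(x)\ \forall z \in H\}$. Sums of set-valued maps are pointwise Minkowski sums (empty if one of the summands is empty). For a set-valued map $A : H \rightrightarrows H$, $\mathrm{D}(A) = \{x \in H : A(x) \neq \emptyset\}$ and $A^{-1}(y) = \{x \in H : y \in A(x)\}$; $I$ is the identity operator. The proximal operator of $g \in \Gamma_0(H)$ is $\mathrm{prox}_g = (I+\partial g)^{-1}$, which is single-valued and defined everywhere on $H$. The $f$-proximal operator of $g$ is the set-valued map $\mathrm{prox}^f_g = (I + \partial g \circ \mathrm{prox}_f)^{-1} : H \rightrightarrows H$; that is, $y \in \mathrm{prox}^f_g(x)$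 if and only if $x - y \in \partial g(\mathrm{prox}_f(y))$. The generalized Douglas–Rachford operator $\overline{\mathcal{DR}}_{f,g} : H \times H \to H$ is defined by $$\overline{\mathcal{DR}}_{f,g}(x,y) = y - \mathrm{prox}_f(y) + \mathrm{prox}_g\big(x + \mathrm{prox}_f(y) - y\big).$$ *)

theory Defs
  imports "HOL-Analysis.Analysis" "HOL-Library.Set_Algebras"
begin

(* A real Hilbert space is a type of sort {real_inner, complete_space}.
   Functions into the reals extended by +oo are modelled as ereal-valued functions
   that avoid the value -oo; this last condition is part of "proper". *)

definition edom :: "('a \<Rightarrow> ereal) \<Rightarrow> 'a set" where
  "edom g = {x. g x < \<infinity>}"

definition proper :: "('a \<Rightarrow> ereal) \<Rightarrow> bool" where
  "proper g \<longleftrightarrow> (\<forall>x. g x \<noteq> - \<infinity>) \<and> edom g \<noteq> {}"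

definition lower_semicontinuous :: "('a::topological_space \<Rightarrow> ereal) \<Rightarrow> bool" where
  "lower_semicontinuous g \<longleftrightarrow> (\<forall>x. g x \<le> Liminf (nhds x) g)"

definition econvex :: "('a::real_vector \<Rightarrow> ereal) \<Rightarrow> bool" where
  "econvex g \<longleftrightarrow>
     (\<forall>x y t. 0 < t \<and> t < 1 \<longrightarrow>
        g (t *\<^sub>R x + (1 - t) *\<^sub>R y) \<le> ereal t * g x + ereal (1 - t) * g y)"

definition Gamma0 :: "('a::real_inner \<Rightarrow> ereal) set" where
  "Gamma0 = {g. proper g \<and> lower_semicontinuous g \<and> econvex g}"

(* For proper g this set is empty when g x = +oo: take z in the domain of g,
   so that g z - g x = -oo. *)
definition subdiff :: "('a::real_inner \<Rightarrow> ereal) \<Rightarrow> 'a \<Rightarrow> 'a set" where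
  "subdiff g x = {y. \<forall>z. ereal (inner y (z - x)) \<le> g z - g x}"

definition svm_domain :: "('a \<Rightarrow> 'b set) \<Rightarrow> 'a set" where
  "svm_domain A = {x. A x \<noteq> {}}"

definition svm_inverse :: "('a \<Rightarrow> 'b set) \<Rightarrow> 'b \<Rightarrow> 'a set" where
  "svm_inverse A y = {x. y \<in> A x}"

(* The addition of sets below is the Minkowski sum.  For g in Gamma0 the inverse of
   I + subdiff g is everywhere a singleton; prox g x denotes its element. *)
definition prox :: "('a::real_inner \<Rightarrow> ereal) \<Rightarrow> 'a \<Rightarrow> 'a" where
  "prox g x = (THE p. p \<in> svm_inverse (\<lambda>u. {u} + subdiff g u) x)"

definition fprox :: "('a::real_inner \<Rightarrow> ereal) \<Rightarrow> ('a \<Rightarrow> ereal) \<Rightarrow> 'a \<Rightarrow> 'a set" where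
  "fprox f g = svm_inverse (\<lambda>y. {y} + subdiff g (prox f y))"

definition gen_DR :: "('a::real_inner \<Rightarrow> ereal) \<Rightarrow> ('a \<Rightarrow> ereal) \<Rightarrow> 'a \<Rightarrow> 'a \<Rightarrow> 'a" where
  "gen_DR f g x y = y - prox f y + prox g (x + prox f y - y)"

definition weakly_converges :: "(nat \<Rightarrow> 'a::real_inner) \<Rightarrow> 'a \<Rightarrow> bool" where
  "weakly_converges s l \<longleftrightarrow> (\<forall>u. (\<lambda>k. inner (s k) u) \<longlonglongrightarrow> inner l u)"

end

theory Submission
  imports Defs
begin

text \<open>
  Write \<open>Q = I - prox f\<close> and \<open>S q = q + prox g (x - q)\<close>.  Then the operator
  \<open>gen_DR f g x\<close> is \<open>S \<circ> Q\<close>, and both factors are firmly nonexpansive: \<open>Q\<close> because it is the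
  complement of a proximal operator, and \<open>S\<close> because \<open>S q = x - (I - prox g) (x - q)\<close> is a
  complement of a proximal operator conjugated by the reflection \<open>q \<mapsto> x - q\<close>.  A composition
  of two firmly nonexpansive operators is averaged (\<open>firmly_nonexpansive_compose\<close>), and the
  fixed points of \<open>gen_DR f g x\<close> are exactly the points of \<open>fprox f g x\<close>
  (\<open>gen_DR_fixed_iff\<close>), so the convergence statement is the weak convergence of the iterates of
  an averaged operator with a fixed point (\<open>averaged_iterates_weakly_converge\<close>).

  Weak convergence is obtained without weak compactness, through asymptotic centers.  For a
  bounded sequence and a filter \<open>F\<close>, the function \<open>u \<mapsto> limsup (norm (s k - u))\<^sup>2\<close> along \<open>F\<close> is
  strongly convex and hence has a unique minimizer, the asymptotic center.  Averagedness makes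
  \<open>s k - T (s k)\<close> tend to zero, so that every such center is a fixed point of \<open>T\<close>; it also
  makes the distance to each fixed point converge, so that the centers along all filters finer
  than \<open>sequentially\<close> coincide.  If the sequence did not converge weakly to the common center
  \<open>c\<close>, then along some finer filter \<open>inner (s k - c) u\<close> would stay above a positive constant,
  and moving \<open>c\<close> slightly in direction \<open>u\<close> would not increase the radius, contradicting
  uniqueness of the center.

  That the proximal operators are defined everywhere is proved by minimizing
  \<open>f u + (norm (u - x))\<^sup>2 / 2\<close>; the same minimization principle
  (\<open>strongly_midconvex_attains_min\<close>) yields the asymptotic centers.  For the last claim, adding
  \<open>y - prox f y \<in> subdiff f (prox f y)\<close> and \<open>x - y \<in> subdiff g (prox f y)\<close> gives
  \<open>x - prox f y \<in> subdiff (\<lambda>v. f v + g v) (prox f y)\<close>, which characterizes the proximal point of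
  the sum.
\<close>

section \<open>Minimizing midpoint-strongly convex functions\<close>

text \<open>
  Strong convexity forces the diameter of the sublevel sets just above the infimum to shrink to
  zero, so by completeness these nested closed sets have a common point.  Extended-valued
  functions fit in through their domain \<open>D\<close>; lower semicontinuity enters only as closedness of
  the sublevel sets.
\<close>
lemma strongly_midconvex_attains_min:
  fixes \<phi> :: "'a::{real_inner, complete_space} \<Rightarrow> real"
  assumes ne: "D \<noteq> {}" and c: "c > 0"
    and below: "\<And>u. u \<in> D \<Longrightarrow> m \<le> \<phi> u"
    and closed: "\<And>M. closed {u \<in> D. \<phi> u \<le> M}"
    and mid: "\<And>u v. u \<in> D \<Longrightarrow> v \<in> D \<Longrightarrow> (1/2) *\<^sub>R (u + v) \<in> D \<and>
      \<phi> ((1/2) *\<^sub>R (u + v)) \<le> (\<phi> u + \<phi> v) / 2 - c * (norm (u - v))\<^sup>2"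
  obtains p where "p \<in> D" "\<And>u. u \<in> D \<Longrightarrow> \<phi> p \<le> \<phi> u"
proof -
  define I where "I = Inf (\<phi> ` D)"
  have bdd: "bdd_below (\<phi> ` D)" using below by (intro bdd_belowI2) auto
  have I_le: "I \<le> \<phi> u" if "u \<in> D" for u
    unfolding I_def using that bdd by (auto intro: cInf_lower)
  define A where "A n = {u \<in> D. \<phi> u \<le> I + c / (real n + 1)}" for n
  have ne_A: "A n \<noteq> {}" for n
  proof -
    have "Inf (\<phi> ` D) < I + c / (real n + 1)"
      unfolding I_def using c by simp
    then obtain u where "u \<in> D" "\<phi> u < I + c / (real n + 1)"
      using cInf_lessD[of "\<phi> ` D"] ne by blast
    then show ?thesis unfolding A_def by force
  qed
  have anti: "A n \<subseteq> A k" if "k \<le> n" for k n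
  proof -
    have "c / (real n + 1) \<le> c / (real k + 1)"
      using that c by (intro divide_left_mono) auto
    then show ?thesis unfolding A_def by auto
  qed
  have small: "\<exists>n. \<forall>u\<in>A n. \<forall>v\<in>A n. dist u v < e" if "e > 0" for e
  proof -
    obtain n where n: "1 / (real n + 1) < e\<^sup>2"
      using reals_Archimedean[of "e\<^sup>2"] \<open>e > 0\<close> by (auto simp: inverse_eq_divide add.commute)
    have "dist u v < e" if u: "u \<in> A n" and v: "v \<in> A n" for u v
    proof -
      have "I \<le> (\<phi> u + \<phi> v) / 2 - c * (norm (u - v))\<^sup>2"
        using mid[of u v] I_le[of "(1/2) *\<^sub>R (u + v)"] u v unfolding A_def by force
      also have "\<dots> \<le> I + c / (real n + 1) - c * (norm (u - v))\<^sup>2"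
        using u v unfolding A_def mem_Collect_eq by argo
      finally have "c * (norm (u - v))\<^sup>2 \<le> c * (1 / (real n + 1))" by simp
      then have "(norm (u - v))\<^sup>2 \<le> 1 / (real n + 1)" using c by (metis mult_le_cancel_left_pos)
      then have "(norm (u - v))\<^sup>2 < e\<^sup>2" using n by simp
      then show ?thesis using \<open>e > 0\<close> unfolding dist_norm by (metis power2_less_imp_less less_imp_le)
    qed
    then show ?thesis by blast
  qed
  have closed_A: "closed (A n)" for n unfolding A_def by (rule closed)
  obtain p where p: "\<And>n. p \<in> A n"
    using decreasing_closed_nest[of A, OF closed_A ne_A anti small] by blast
  have "(\<lambda>n. I + c * (1 / (real n + 1))) \<longlonglongrightarrow> I + c * 0"
    using LIMSEQ_inverse_real_of_nat
    by (intro tendsto_intros) (simp add: inverse_eq_divide add.commute)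
  then have "\<phi> p \<le> I + c * 0"
    by (rule LIMSEQ_le_const) (use p in \<open>auto simp: A_def\<close>)
  then show thesis using that[of p] p[of 0] I_le unfolding A_def by force
qed

section \<open>Proximal operators\<close>

lemma proper_ereal_of_edom:
  assumes "proper f" "u \<in> edom f"
  shows "f u = ereal (real_of_ereal (f u))"
  using assms unfolding proper_def edom_def by (cases "f u") auto

lemma proper_not_edom:
  assumes "u \<notin> edom f"
  shows "f u = \<infinity>"
  using assms unfolding edom_def by auto

lemma mem_subdiff_iff:
  fixes f :: "'a::real_inner \<Rightarrow> ereal"
  assumes "proper f"
  shows "w \<in> subdiff f p \<longleftrightarrow> p \<in> edom f \<and>
    (\<forall>z\<in>edom f. inner w (z - p) \<le> real_of_ereal (f z) - real_of_ereal (f p))"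
proof (cases "p \<in> edom f")
  case True
  obtain r where r: "f p = ereal r" using proper_ereal_of_edom[OF assms True] by blast
  have "ereal (inner w (z - p)) \<le> f z - f p \<longleftrightarrow>
    (z \<in> edom f \<longrightarrow> inner w (z - p) \<le> real_of_ereal (f z) - real_of_ereal (f p))" for z
  proof (cases "z \<in> edom f")
    case True
    then obtain t where "f z = ereal t" using proper_ereal_of_edom[OF assms] by blast
    then show ?thesis using r True by simp
  qed (simp add: proper_not_edom r)
  then show ?thesis using True unfolding subdiff_def by blast
next
  case False
  obtain z where z: "z \<in> edom f" using assms unfolding proper_def by blast
  then obtain t where "f z = ereal t" using proper_ereal_of_edom[OF assms] by blast
  then show ?thesis using False proper_not_edom[OF False] unfolding subdiff_def
    by (auto intro!: exI[of _ z])
qed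

lemma subdiff_monotone:
  fixes f :: "'a::real_inner \<Rightarrow> ereal"
  assumes "proper f" "v \<in> subdiff f p" "w \<in> subdiff f q"
  shows "0 \<le> inner (v - w) (p - q)"
proof -
  have "inner v (q - p) \<le> real_of_ereal (f q) - real_of_ereal (f p)"
    "inner w (p - q) \<le> real_of_ereal (f p) - real_of_ereal (f q)"
    using assms mem_subdiff_iff[OF assms(1)] by blast+
  then show ?thesis by (simp add: inner_diff_left inner_diff_right)
qed

lemma mem_resolvent_iff:
  fixes A :: "'a::real_vector \<Rightarrow> 'a set"
  shows "p \<in> svm_inverse (\<lambda>u. {u} + A u) x \<longleftrightarrow> x - p \<in> A p"
  unfolding svm_inverse_def set_plus_def by (auto simp: algebra_simps intro!: bexI[of _ "x - p"])

text \<open>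
  Two proximal points of \<open>x\<close> coincide by monotonicity of the subdifferential.  The generality of
  proper functions is what the sum \<open>\<lambda>v. f v + g v\<close> calls for.
\<close>
lemma prox_eqI:
  fixes f :: "'a::real_inner \<Rightarrow> ereal"
  assumes "proper f" "x - p \<in> subdiff f p"
  shows "prox f x = p"
  unfolding prox_def
proof (rule the_equality)
  show "p \<in> svm_inverse (\<lambda>u. {u} + subdiff f u) x"
    using assms(2) by (simp add: mem_resolvent_iff)
next
  fix q assume "q \<in> svm_inverse (\<lambda>u. {u} + subdiff f u) x"
  then have "x - q \<in> subdiff f q" by (simp add: mem_resolvent_iff)
  from subdiff_monotone[OF assms(1) this assms(2)]
  have "inner (p - q) (p - q) \<le> 0"
    by (simp add: inner_diff_left inner_diff_right inner_commute)
  then show "q = p" by (metis inner_gt_zero_iff not_le right_minus_eq)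
qed

lemma Gamma0_real_convex:
  assumes "f \<in> Gamma0" "u \<in> edom f" "v \<in> edom f" "0 < t" "t < 1"
  shows "t *\<^sub>R u + (1 - t) *\<^sub>R v \<in> edom f"
    and "real_of_ereal (f (t *\<^sub>R u + (1 - t) *\<^sub>R v))
      \<le> t * real_of_ereal (f u) + (1 - t) * real_of_ereal (f v)"
proof -
  let ?w = "t *\<^sub>R u + (1 - t) *\<^sub>R v"
  have P: "proper f" using assms(1) unfolding Gamma0_def by blast
  have "f ?w \<le> ereal t * f u + ereal (1 - t) * f v"
    using assms unfolding Gamma0_def econvex_def by blast
  also have "\<dots> = ereal (t * real_of_ereal (f u) + (1 - t) * real_of_ereal (f v))"
    by (subst (1) proper_ereal_of_edom[OF P assms(2)], subst (1) proper_ereal_of_edom[OF P assms(3)]) simp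
  finally have le: "f ?w \<le> ereal (t * real_of_ereal (f u) + (1 - t) * real_of_ereal (f v))" .
  then show w: "?w \<in> edom f" unfolding edom_def by (auto intro: le_less_trans)
  show "real_of_ereal (f ?w) \<le> t * real_of_ereal (f u) + (1 - t) * real_of_ereal (f v)"
    using le proper_ereal_of_edom[OF P w] by (metis ereal_less_eq(3))
qed

lemma Gamma0_eventually_greater:
  assumes "f \<in> Gamma0" "ereal C < f p"
  shows "eventually (\<lambda>u. ereal C < f u) (nhds p)"
proof -
  have "f p \<le> Liminf (nhds p) f"
    using assms(1) unfolding Gamma0_def lower_semicontinuous_def by blast
  with assms(2) show ?thesis by (auto simp: le_Liminf_iff)
qed

text \<open>
  An elementary replacement for an affine minorant: lower semicontinuity bounds \<open>f\<close> from below
  on a small ball around a point \<open>u0\<close> of its domain, and convexity along the segment from \<open>u0\<close>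
  to \<open>u\<close> propagates this bound with at most linear decay.  Linear decay suffices because it is
  absorbed by the quadratic term in the definition of the proximal point.
\<close>
lemma Gamma0_cone_minorant:
  fixes f :: "'a::real_inner \<Rightarrow> ereal"
  assumes "f \<in> Gamma0"
  obtains u0 a b where "\<And>u. u \<in> edom f \<Longrightarrow> a - b * norm (u - u0) \<le> real_of_ereal (f u)"
proof -
  have P: "proper f" using assms unfolding Gamma0_def by blast
  then obtain u0 where u0: "u0 \<in> edom f" unfolding proper_def by blast
  define r where "r = real_of_ereal (f u0)"
  have "ereal (r - 1) < f u0"
    unfolding r_def by (subst (2) proper_ereal_of_edom[OF P u0]) simp
  from Gamma0_eventually_greater[OF assms this]
  obtain d where d: "d > 0" "\<And>u. dist u u0 < d \<Longrightarrow> ereal (r - 1) < f u"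
    unfolding eventually_nhds_metric by blast
  have near: "r - 1 < real_of_ereal (f u)" if "u \<in> edom f" "dist u u0 < d" for u
    using d(2)[OF that(2)] proper_ereal_of_edom[OF P that(1)] by (metis less_ereal.simps(1))
  \<comment> \<open>This slope makes the point \<open>w\<close> at fraction \<open>1 / (b * n)\<close> of the segment lie at distance
    \<open>d / 2\<close> from \<open>u0\<close>.\<close>
  define b where "b = 2 / d"
  have b: "b > 0" using d(1) by (simp add: b_def)
  have "(r - 1) - b * norm (u - u0) \<le> real_of_ereal (f u)" if u: "u \<in> edom f" for u
  proof (cases "dist u u0 < d")
    case True
    have "0 \<le> b * norm (u - u0)" using b by simp
    with near[OF u True] show ?thesis by linarith
  next
    case False
    define n where "n = norm (u - u0)"
    have n: "n \<ge> d" using False by (simp add: n_def dist_norm)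
    define t where "t = 1 / (b * n)"
    have bn: "b * n \<ge> 2" using n d(1) by (simp add: b_def field_simps)
    have t: "0 < t" "t < 1" using bn by (auto simp: t_def)
    define w where "w = t *\<^sub>R u + (1 - t) *\<^sub>R u0"
    have "w - u0 = t *\<^sub>R (u - u0)" by (simp add: w_def algebra_simps)
    then have "dist w u0 = t * n" using t by (simp add: dist_norm n_def)
    also have "\<dots> = d / 2" using n d(1) by (simp add: t_def b_def)
    finally have "dist w u0 < d" using d(1) by simp
    with near Gamma0_real_convex[OF assms u u0 t]
    have "r - 1 < t * real_of_ereal (f u) + (1 - t) * r" unfolding w_def r_def by force
    then have "t * (r - real_of_ereal (f u)) < 1" by (simp add: algebra_simps)
    then have "r - real_of_ereal (f u) < b * n"
      using bn by (simp add: t_def field_simps)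
    then show ?thesis unfolding n_def by simp
  qed
  then show thesis using that by blast
qed

lemma norm_midpoint_sq:
  fixes u v :: "'a::real_inner"
  shows "(norm ((1/2) *\<^sub>R (u + v) - x))\<^sup>2
    = ((norm (u - x))\<^sup>2 + (norm (v - x))\<^sup>2) / 2 - (norm (u - v))\<^sup>2 / 4"
  by (simp add: power2_norm_eq_inner inner_add_left inner_add_right inner_diff_left
      inner_diff_right inner_commute field_simps)

text \<open>
  The minimizer \<open>p\<close> of \<open>f u + (norm (u - x))\<^sup>2 / 2\<close> works: comparing the value at \<open>p\<close> with the
  value at \<open>p + t (z - p)\<close>, dividing by \<open>t\<close> and letting \<open>t\<close> tend to zero gives the subgradient
  inequality at \<open>z\<close>.
\<close>
lemma ex_prox:
  fixes f :: "'a::{real_inner, complete_space} \<Rightarrow> ereal"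
  assumes "f \<in> Gamma0"
  shows "\<exists>p. x - p \<in> subdiff f p"
proof -
  have P: "proper f" using assms unfolding Gamma0_def by blast
  define F where "F u = real_of_ereal (f u)" for u
  define \<phi> where "\<phi> u = F u + (norm (u - x))\<^sup>2 / 2" for u
  have fF: "f u = ereal (F u)" if "u \<in> edom f" for u
    unfolding F_def using proper_ereal_of_edom[OF P that] .
  obtain u0 a b where minor: "\<And>u. u \<in> edom f \<Longrightarrow> a - b * norm (u - u0) \<le> F u"
    using Gamma0_cone_minorant[OF assms] unfolding F_def by metis
  have below: "a - \<bar>b\<bar> * norm (x - u0) - b\<^sup>2 / 2 \<le> \<phi> u" if "u \<in> edom f" for u
  proof -
    have "b * norm (u - u0) \<le> \<bar>b\<bar> * norm (u - u0)" by (simp add: mult_right_mono)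
    also have "\<dots> \<le> \<bar>b\<bar> * (norm (u - x) + norm (x - u0))"
      using norm_triangle_ineq[of "u - x" "x - u0"] by (intro mult_left_mono) auto
    finally have "b * norm (u - u0) \<le> \<bar>b\<bar> * norm (u - x) + \<bar>b\<bar> * norm (x - u0)"
      by (simp add: algebra_simps)
    moreover have "0 \<le> (norm (u - x) - \<bar>b\<bar>)\<^sup>2" by simp
    ultimately show ?thesis using minor[OF that] unfolding \<phi>_def
      by (simp add: power2_diff algebra_simps)
  qed
  \<comment> \<open>Separating \<open>f\<close> from the continuous quadratic term by an intermediate constant \<open>C\<close> avoids
    lower semicontinuity of an extended-valued sum.\<close>
  have closed: "closed {u \<in> edom f. \<phi> u \<le> M}" for M
  proof -
    let ?q = "\<lambda>u. M - (norm (u - x))\<^sup>2 / 2"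
    have eq: "- {u \<in> edom f. \<phi> u \<le> M} = {u. ereal (?q u) < f u}"
    proof (intro set_eqI)
      fix u show "u \<in> - {u \<in> edom f. \<phi> u \<le> M} \<longleftrightarrow> u \<in> {u. ereal (?q u) < f u}"
        by (cases "u \<in> edom f") (auto simp: fF \<phi>_def proper_not_edom)
    qed
    have "eventually (\<lambda>u. ereal (?q u) < f u) (nhds p)" if p: "ereal (?q p) < f p" for p
    proof -
      obtain C where C: "ereal (?q p) < ereal C" "ereal C < f p"
        using ereal_dense2[OF p] by blast
      have "(?q \<longlongrightarrow> ?q p) (nhds p)"
        by (intro tendsto_intros filterlim_ident) auto
      then have "eventually (\<lambda>u. ?q u < C) (nhds p)" using C(1) order_tendstoD(2) by fastforce
      with Gamma0_eventually_greater[OF assms C(2)] show ?thesis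
        by eventually_elim (meson less_ereal.simps(1) less_trans)
    qed
    then have "open {u. ereal (?q u) < f u}"
      unfolding open_dist eventually_nhds_metric by (auto simp: dist_commute)
    then show ?thesis unfolding closed_def eq .
  qed
  have mid: "(1/2) *\<^sub>R (u + v) \<in> edom f \<and>
      \<phi> ((1/2) *\<^sub>R (u + v)) \<le> (\<phi> u + \<phi> v) / 2 - (1/8) * (norm (u - v))\<^sup>2"
    if "u \<in> edom f" "v \<in> edom f" for u v
    using Gamma0_real_convex[OF assms that, of "1/2"] norm_midpoint_sq[of u v x]
    unfolding \<phi>_def F_def by (simp add: scaleR_add_right add_divide_distrib diff_divide_distrib)
  have "edom f \<noteq> {}" using P unfolding proper_def by blast
  then obtain p where p: "p \<in> edom f" and min: "\<And>u. u \<in> edom f \<Longrightarrow> \<phi> p \<le> \<phi> u"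
    using strongly_midconvex_attains_min[of "edom f" "1/8" _ \<phi>] below closed mid by auto
  have "inner (x - p) (z - p) \<le> F z - F p" if z: "z \<in> edom f" for z
  proof -
    have *: "F p - F z + inner (x - p) (z - p) \<le> t * ((norm (z - p))\<^sup>2 / 2)"
      if t: "0 < t" "t < 1" for t
    proof -
      define w where "w = t *\<^sub>R z + (1 - t) *\<^sub>R p"
      define E where "E = inner (x - p) (z - p)"
      define N where "N = (norm (z - p))\<^sup>2"
      have "(norm (w - x))\<^sup>2 = (norm (p - x))\<^sup>2 + t * (t * N - 2 * E)"
        by (simp add: w_def E_def N_def power2_norm_eq_inner inner_add_left inner_add_right
            inner_diff_left inner_diff_right inner_commute algebra_simps)
      moreover have "\<phi> p \<le> t * F z + (1 - t) * F p + (norm (w - x))\<^sup>2 / 2"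
        using min[of w] Gamma0_real_convex[OF assms z p t] unfolding \<phi>_def F_def w_def by fastforce
      ultimately have "0 \<le> t * (F z - F p - E + t * (N / 2))"
        unfolding \<phi>_def by (simp add: algebra_simps add_divide_distrib diff_divide_distrib)
      then show ?thesis using t unfolding E_def[symmetric] N_def[symmetric]
        by (simp add: zero_le_mult_iff)
    qed
    have "((\<lambda>t. t * ((norm (z - p))\<^sup>2 / 2)) \<longlongrightarrow> 0 * ((norm (z - p))\<^sup>2 / 2)) (at_right 0)"
      by (intro tendsto_intros)
    moreover have "eventually (\<lambda>t::real. 0 < t \<and> t < 1) (at_right 0)"
      by (metis (mono_tags, lifting) eventually_at_right_field zero_less_one)
    ultimately have "F p - F z + inner (x - p) (z - p) \<le> 0 * ((norm (z - p))\<^sup>2 / 2)"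
      using * by (intro tendsto_lowerbound[of _ _ "at_right 0"]) (auto elim: eventually_mono)
    then show ?thesis by simp
  qed
  then show ?thesis using p mem_subdiff_iff[OF P] unfolding F_def by blast
qed

lemma prox_mem:
  fixes f :: "'a::{real_inner, complete_space} \<Rightarrow> ereal"
  assumes "f \<in> Gamma0"
  shows "x - prox f x \<in> subdiff f (prox f x)"
  using ex_prox[OF assms, of x] prox_eqI[of f x] assms unfolding Gamma0_def by force

section \<open>Firmly nonexpansive operators\<close>

text \<open>
  Among the equivalent forms of firm nonexpansiveness this one is symmetric in \<open>T\<close> and \<open>I - T\<close>,
  and it chains under composition.
\<close>
definition firmly_nonexpansive :: "('a::real_inner \<Rightarrow> 'a) \<Rightarrow> bool" where
  "firmly_nonexpansive T \<longleftrightarrow>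
    (\<forall>u v. (norm (T u - T v))\<^sup>2 + (norm ((u - T u) - (v - T v)))\<^sup>2 \<le> (norm (u - v))\<^sup>2)"

lemma firmly_nonexpansive_complement:
  assumes "firmly_nonexpansive T"
  shows "firmly_nonexpansive (\<lambda>u. u - T u)"
  using assms unfolding firmly_nonexpansive_def by (simp add: add.commute)

lemma firmly_nonexpansive_reflect:
  assumes "firmly_nonexpansive T"
  shows "firmly_nonexpansive (\<lambda>u. a - T (a - u))"
  unfolding firmly_nonexpansive_def
proof (intro allI)
  fix u v
  have "(norm (T (a - v) - T (a - u)))\<^sup>2 + (norm (((a - v) - T (a - v)) - ((a - u) - T (a - u))))\<^sup>2
      \<le> (norm ((a - v) - (a - u)))\<^sup>2"
    using assms unfolding firmly_nonexpansive_def by blast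
  then show "(norm ((a - T (a - u)) - (a - T (a - v))))\<^sup>2
      + (norm ((u - (a - T (a - u))) - (v - (a - T (a - v)))))\<^sup>2 \<le> (norm (u - v))\<^sup>2"
    by (simp add: algebra_simps)
qed

lemma firmly_nonexpansive_prox:
  fixes f :: "'a::{real_inner, complete_space} \<Rightarrow> ereal"
  assumes "f \<in> Gamma0"
  shows "firmly_nonexpansive (prox f)"
  unfolding firmly_nonexpansive_def
proof (intro allI)
  fix u v
  let ?p = "prox f u - prox f v" and ?q = "(u - prox f u) - (v - prox f v)"
  have "0 \<le> inner ?q ?p"
    using subdiff_monotone[OF _ prox_mem[OF assms] prox_mem[OF assms]] assms
    unfolding Gamma0_def by blast
  moreover have "u - v = ?p + ?q" by simp
  then have "(norm (u - v))\<^sup>2 = (norm ?p)\<^sup>2 + 2 * inner ?q ?p + (norm ?q)\<^sup>2"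
    by (simp only: power2_norm_eq_inner inner_add_left inner_add_right inner_commute[of ?p ?q])
  ultimately show "(norm ?p)\<^sup>2 + (norm ?q)\<^sup>2 \<le> (norm (u - v))\<^sup>2" by linarith
qed

text \<open>
  The displacement of \<open>S \<circ> Q\<close> is the sum of the displacements of the two factors; the factor
  \<open>1/2\<close> comes from \<open>(norm (a + b))\<^sup>2 \<le> 2 (norm a)\<^sup>2 + 2 (norm b)\<^sup>2\<close>.
\<close>
lemma firmly_nonexpansive_compose:
  assumes S: "firmly_nonexpansive S" and Q: "firmly_nonexpansive Q"
  shows "(norm (S (Q u) - S (Q v)))\<^sup>2 + (norm ((u - S (Q u)) - (v - S (Q v))))\<^sup>2 / 2
    \<le> (norm (u - v))\<^sup>2"
proof -
  let ?a = "(u - Q u) - (v - Q v)" and ?b = "(Q u - S (Q u)) - (Q v - S (Q v))"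
  have "(norm (S (Q u) - S (Q v)))\<^sup>2 + (norm ?b)\<^sup>2 \<le> (norm (Q u - Q v))\<^sup>2"
    "(norm (Q u - Q v))\<^sup>2 + (norm ?a)\<^sup>2 \<le> (norm (u - v))\<^sup>2"
    using S Q unfolding firmly_nonexpansive_def by blast+
  moreover have "(u - S (Q u)) - (v - S (Q v)) = ?a + ?b" by simp
  moreover have "(norm (?a + ?b))\<^sup>2 + (norm (?a - ?b))\<^sup>2 = 2 * (norm ?a)\<^sup>2 + 2 * (norm ?b)\<^sup>2"
    unfolding power2_norm_eq_inner
    by (simp only: inner_add_left inner_add_right inner_diff_left[of ?a ?b]
        inner_diff_right[of _ ?a ?b])
  moreover have "0 \<le> (norm (?a - ?b))\<^sup>2" by simp
  ultimately show ?thesis by (smt (verit) field_sum_of_halves)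
qed

section \<open>Asymptotic centers\<close>

text \<open>
  For bounded \<open>s\<close> and a nontrivial filter this is the limit superior of \<open>(norm (s k - u))\<^sup>2\<close>
  along \<open>F\<close>, written as a real infimum.  An arbitrary filter takes the place of subsequences.
\<close>
definition asymptotic_sqradius :: "'i filter \<Rightarrow> ('i \<Rightarrow> 'a::real_normed_vector) \<Rightarrow> 'a \<Rightarrow> real" where
  "asymptotic_sqradius F s u = Inf {M. eventually (\<lambda>k. (norm (s k - u))\<^sup>2 \<le> M) F}"

lemma eventual_sqdist_bound_nonneg:
  assumes "F \<noteq> bot" and "eventually (\<lambda>k. (norm (s k - u))\<^sup>2 \<le> M) F"
  shows "0 \<le> M"
proof -
  obtain k where "(norm (s k - u))\<^sup>2 \<le> M" using eventually_happens[OF assms(2)] assms(1) by auto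
  then show ?thesis by (meson order_trans zero_le_power2)
qed

lemma asymptotic_sqradius_le:
  assumes "F \<noteq> bot" and "eventually (\<lambda>k. (norm (s k - u))\<^sup>2 \<le> M) F"
  shows "asymptotic_sqradius F s u \<le> M"
  unfolding asymptotic_sqradius_def
  using assms eventual_sqdist_bound_nonneg by (intro cInf_lower bdd_belowI) (auto intro: bdd_belowI)

lemma bounded_range_dist:
  fixes s :: "'i \<Rightarrow> 'a::real_normed_vector"
  assumes "bounded (range s)"
  obtains B where "B \<ge> 0" "\<And>k. norm (s k - u) \<le> B"
proof -
  obtain B where B: "\<And>k. norm (s k) \<le> B" using assms unfolding bounded_iff by auto
  have "norm (s k - u) \<le> B + norm u" for k
    using B[of k] norm_triangle_ineq4[of "s k" u] by linarith
  moreover have "0 \<le> B + norm u"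
    using norm_ge_zero[of "s undefined"] B[of undefined] norm_ge_zero[of u] by linarith
  ultimately show thesis using that by blast
qed

lemma eventually_le_asymptotic_sqradius:
  fixes s :: "'i \<Rightarrow> 'a::real_normed_vector"
  assumes "bounded (range s)" "e > 0"
  shows "eventually (\<lambda>k. (norm (s k - u))\<^sup>2 \<le> asymptotic_sqradius F s u + e) F"
proof -
  obtain B where "\<And>k. norm (s k - u) \<le> B" using bounded_range_dist[OF assms(1)] by blast
  then have "eventually (\<lambda>k. (norm (s k - u))\<^sup>2 \<le> B\<^sup>2) F" by (simp add: power_mono)
  then have "{M. eventually (\<lambda>k. (norm (s k - u))\<^sup>2 \<le> M) F} \<noteq> {}" by blast
  from cInf_lessD[OF this, of "asymptotic_sqradius F s u + e"] obtain M where
    "eventually (\<lambda>k. (norm (s k - u))\<^sup>2 \<le> M) F" "M < asymptotic_sqradius F s u + e"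
    using assms(2) unfolding asymptotic_sqradius_def by auto
  then show ?thesis by (auto elim: eventually_mono)
qed

lemma asymptotic_sqradius_eq_lim:
  fixes s :: "'i \<Rightarrow> 'a::real_normed_vector"
  assumes "F \<noteq> bot" "bounded (range s)" "((\<lambda>k. (norm (s k - u))\<^sup>2) \<longlongrightarrow> L) F"
  shows "asymptotic_sqradius F s u = L"
proof (rule antisym)
  show "asymptotic_sqradius F s u \<le> L"
  proof (rule field_le_epsilon)
    fix e :: real assume "e > 0"
    then have "eventually (\<lambda>k. (norm (s k - u))\<^sup>2 < L + e) F"
      using assms(3) by (intro order_tendstoD) auto
    then show "asymptotic_sqradius F s u \<le> L + e"
      by (intro asymptotic_sqradius_le[OF assms(1)]) (auto elim: eventually_mono)
  qed
  show "L \<le> asymptotic_sqradius F s u"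
  proof (rule field_le_epsilon)
    fix e :: real assume "e > 0"
    from eventually_le_asymptotic_sqradius[OF assms(2) this]
    show "L \<le> asymptotic_sqradius F s u + e"
      using assms(1,3) tendsto_upperbound by blast
  qed
qed

lemma asymptotic_sqradius_perturb:
  fixes s :: "'i \<Rightarrow> 'a::real_normed_vector"
  assumes "F \<noteq> bot" "bounded (range s)"
    and "eventually (\<lambda>k. (norm (s k - v))\<^sup>2 \<le> (norm (s k - u))\<^sup>2 + d k) F" "(d \<longlongrightarrow> D) F"
  shows "asymptotic_sqradius F s v \<le> asymptotic_sqradius F s u + D"
proof (rule field_le_epsilon)
  fix e :: real assume e: "e > 0"
  have "eventually (\<lambda>k. d k < D + e / 2) F" using assms(4) e by (intro order_tendstoD) auto
  moreover have "eventually (\<lambda>k. (norm (s k - u))\<^sup>2 \<le> asymptotic_sqradius F s u + e / 2) F"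
    using e by (intro eventually_le_asymptotic_sqradius assms) auto
  ultimately have "eventually (\<lambda>k. (norm (s k - v))\<^sup>2 \<le> asymptotic_sqradius F s u + D + e) F"
    using assms(3) by eventually_elim (simp add: field_sum_of_halves)
  then show "asymptotic_sqradius F s v \<le> asymptotic_sqradius F s u + D + e"
    by (rule asymptotic_sqradius_le[OF assms(1)])
qed

lemma asymptotic_sqradius_midpoint:
  fixes s :: "'i \<Rightarrow> 'a::real_inner"
  assumes "F \<noteq> bot" "bounded (range s)"
  shows "asymptotic_sqradius F s ((1/2) *\<^sub>R (u + v))
    \<le> (asymptotic_sqradius F s u + asymptotic_sqradius F s v) / 2 - (1/4) * (norm (u - v))\<^sup>2"
proof (rule field_le_epsilon)
  fix e :: real assume e: "e > 0"
  have "eventually (\<lambda>k. (norm (s k - u))\<^sup>2 \<le> asymptotic_sqradius F s u + e) F"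
    "eventually (\<lambda>k. (norm (s k - v))\<^sup>2 \<le> asymptotic_sqradius F s v + e) F"
    using e by (intro eventually_le_asymptotic_sqradius assms; simp)+
  then have "eventually (\<lambda>k. (norm (s k - (1/2) *\<^sub>R (u + v)))\<^sup>2
      \<le> (asymptotic_sqradius F s u + asymptotic_sqradius F s v) / 2 - (1/4) * (norm (u - v))\<^sup>2 + e) F"
  proof eventually_elim
    case (elim k)
    then show ?case using norm_midpoint_sq[of u v "s k"]
      unfolding norm_minus_commute[of "s k"] by argo
  qed
  then show "asymptotic_sqradius F s ((1/2) *\<^sub>R (u + v))
    \<le> (asymptotic_sqradius F s u + asymptotic_sqradius F s v) / 2 - (1/4) * (norm (u - v))\<^sup>2 + e"
    by (rule asymptotic_sqradius_le[OF assms(1)])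
qed

text \<open>
  The squared radius inherits the parallelogram inequality, hence the minimization principle
  applies and the minimizer is unique.  Closedness of its sublevel sets follows from a Lipschitz
  estimate around the limit point.
\<close>
lemma ex_asymptotic_center:
  fixes s :: "'i \<Rightarrow> 'a::{real_inner, complete_space}"
  assumes F: "F \<noteq> bot" and bdd: "bounded (range s)"
  obtains c where "\<And>u. asymptotic_sqradius F s u \<le> asymptotic_sqradius F s c \<Longrightarrow> u = c"
    "\<And>u. asymptotic_sqradius F s c \<le> asymptotic_sqradius F s u"
proof -
  let ?R = "asymptotic_sqradius F s"
  have nonneg: "0 \<le> ?R u" for u
    by (rule field_le_epsilon)
      (meson F eventual_sqdist_bound_nonneg bdd eventually_le_asymptotic_sqradius)
  have closed: "closed {u. ?R u \<le> M}" for M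
    unfolding closed_sequential_limits
  proof (intro allI impI, elim conjE, simp)
    fix w p assume w: "\<forall>n. ?R (w n) \<le> M" and lim: "w \<longlonglongrightarrow> p"
    obtain B where B: "B \<ge> 0" "\<And>k. norm (s k - p) \<le> B" using bounded_range_dist[OF bdd] by blast
    have "?R p \<le> M + norm (w n - p) * (2 * B)" for n
    proof -
      have "(norm (s k - p))\<^sup>2 \<le> (norm (s k - w n))\<^sup>2 + norm (w n - p) * (2 * B)" for k
      proof -
        have "(norm (s k - w n))\<^sup>2 = (norm (s k - p))\<^sup>2 - 2 * inner (s k - p) (w n - p) + (norm (w n - p))\<^sup>2"
          by (simp add: power2_norm_eq_inner inner_diff_left inner_diff_right inner_commute)
        moreover have "inner (s k - p) (w n - p) \<le> B * norm (w n - p)"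
          using norm_cauchy_schwarz[of "s k - p" "w n - p"] mult_right_mono[OF B(2)[of k], of "norm (w n - p)"]
          by simp
        moreover have "0 \<le> (norm (w n - p))\<^sup>2" by simp
        moreover have "norm (w n - p) * (2 * B) = 2 * (B * norm (w n - p))" by simp
        ultimately show ?thesis by linarith
      qed
      then have "?R p \<le> ?R (w n) + norm (w n - p) * (2 * B)"
        by (intro asymptotic_sqradius_perturb[OF F bdd _ tendsto_const]) auto
      then show ?thesis using w by (smt (verit))
    qed
    moreover have "(\<lambda>n. M + norm (w n - p) * (2 * B)) \<longlonglongrightarrow> M + norm (p - p) * (2 * B)"
      by (intro tendsto_intros lim)
    ultimately show "?R p \<le> M" by (metis (no_types, lifting) LIMSEQ_le_const add_0_right diff_self mult_zero_left norm_zero)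
  qed
  have mid: "?R ((1/2) *\<^sub>R (u + v)) \<le> (?R u + ?R v) / 2 - (1/4) * (norm (u - v))\<^sup>2" for u v
    by (rule asymptotic_sqradius_midpoint[OF F bdd])
  obtain c where c: "\<And>u. ?R c \<le> ?R u"
    using strongly_midconvex_attains_min[of UNIV "1/4" 0 ?R] nonneg closed mid by auto
  have "u = c" if "?R u \<le> ?R c" for u
  proof -
    have "(norm (u - c))\<^sup>2 \<le> 0" using mid[of u c] c[of "(1/2) *\<^sub>R (u + c)"] that by argo
    then show ?thesis by simp
  qed
  then show thesis using that c by blast
qed

section \<open>Weak convergence of iterates\<close>

text \<open>
  Since \<open>s k\<close> and \<open>T (s k)\<close> are asymptotically equal and \<open>T\<close> is nonexpansive, the point \<open>T c\<close>
  has no larger asymptotic radius than \<open>c\<close>, and so equals \<open>c\<close> by uniqueness.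
\<close>
lemma asymptotic_center_fixed:
  fixes s :: "nat \<Rightarrow> 'a::real_inner"
  assumes F: "F \<noteq> bot" and bdd: "bounded (range s)"
    and nonexp: "\<And>u v. norm (T u - T v) \<le> norm (u - v)"
    and reg: "((\<lambda>k. s k - T (s k)) \<longlongrightarrow> 0) F"
    and c: "\<And>u. asymptotic_sqradius F s u \<le> asymptotic_sqradius F s c \<Longrightarrow> u = c"
  shows "T c = c"
proof -
  obtain B where B: "B \<ge> 0" "\<And>k. norm (s k - c) \<le> B" using bounded_range_dist[OF bdd] by blast
  define d where "d k = norm (s k - T (s k)) * (norm (s k - T (s k)) + 2 * B)" for k
  have "(norm (s k - T c))\<^sup>2 \<le> (norm (s k - c))\<^sup>2 + d k" for k
  proof -
    let ?n = "norm (s k - T (s k))"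
    have "norm (s k - T c) \<le> ?n + norm (T (s k) - T c)"
      using norm_triangle_ineq[of "s k - T (s k)" "T (s k) - T c"] by simp
    then have "norm (s k - T c) \<le> ?n + norm (s k - c)" using nonexp[of "s k" c] by linarith
    then have "(norm (s k - T c))\<^sup>2 \<le> (?n + norm (s k - c))\<^sup>2" by (intro power_mono) auto
    also have "\<dots> = (norm (s k - c))\<^sup>2 + ?n * (?n + 2 * norm (s k - c))"
      by (simp add: power2_eq_square algebra_simps)
    also have "\<dots> \<le> (norm (s k - c))\<^sup>2 + d k"
      unfolding d_def using B(2)[of k] by (intro add_left_mono mult_left_mono) auto
    finally show ?thesis .
  qed
  moreover have "(d \<longlongrightarrow> norm (0::'a) * (norm (0::'a) + 2 * B)) F"
    unfolding d_def by (intro tendsto_intros reg)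
  ultimately have "asymptotic_sqradius F s (T c) \<le> asymptotic_sqradius F s c + 0"
    by (intro asymptotic_sqradius_perturb[OF F bdd, where d = d]) auto
  then show ?thesis using c by simp
qed

text \<open>
  The limit is the asymptotic center \<open>c\<close> along \<open>sequentially\<close>.  The step \<open>same\<close> carries the
  argument: distances to fixed points converge, so on fixed points the radius does not depend on
  the filter, and the centers, all of which are fixed points, must agree.
\<close>
lemma averaged_iterates_weakly_converge:
  fixes s :: "nat \<Rightarrow> 'a::{real_inner, complete_space}"
  assumes \<kappa>: "\<kappa> > 0"
    and av: "\<And>u v. (norm (T u - T v))\<^sup>2 + \<kappa> * (norm ((u - T u) - (v - T v)))\<^sup>2 \<le> (norm (u - v))\<^sup>2"
    and z: "T z = z"
    and s: "\<And>k. s (Suc k) = T (s k)"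
  obtains c where "T c = c" "weakly_converges s c"
proof -
  have nonexp: "norm (T u - T v) \<le> norm (u - v)" for u v
  proof -
    have "0 \<le> \<kappa> * (norm ((u - T u) - (v - T v)))\<^sup>2" using \<kappa> by simp
    then have "(norm (T u - T v))\<^sup>2 \<le> (norm (u - v))\<^sup>2" using av[of u v] by linarith
    then show ?thesis by (rule power2_le_imp_le) simp
  qed
  have step: "(norm (s (Suc k) - w))\<^sup>2 + \<kappa> * (norm (s k - T (s k)))\<^sup>2 \<le> (norm (s k - w))\<^sup>2"
    if "T w = w" for k w
    using av[of "s k" w] that by (simp add: s)
  have dec: "decseq (\<lambda>k. (norm (s k - w))\<^sup>2)" if "T w = w" for w
    unfolding decseq_Suc_iff
  proof
    fix k
    have "0 \<le> \<kappa> * (norm (s k - T (s k)))\<^sup>2" using \<kappa> by simp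
    then show "(norm (s (Suc k) - w))\<^sup>2 \<le> (norm (s k - w))\<^sup>2" using step[OF that, of k] by linarith
  qed
  have conv: "\<exists>L. (\<lambda>k. (norm (s k - w))\<^sup>2) \<longlonglongrightarrow> L" if "T w = w" for w
    using decseq_convergent[OF dec[OF that], of 0] by auto
  have bdd: "bounded (range s)"
  proof -
    have "norm (s k - z) \<le> norm (s 0 - z)" for k
      by (rule power2_le_imp_le[OF decseqD[OF dec[OF z]]]) auto
    then have "range s \<subseteq> cball z (norm (s 0 - z))" by (auto simp: dist_norm norm_minus_commute)
    then show ?thesis using bounded_cball bounded_subset by blast
  qed
  \<comment> \<open>Asymptotic regularity: the squared displacements are bounded by the successive decreases
    of a convergent sequence.\<close>
  have reg: "(\<lambda>k. s k - T (s k)) \<longlonglongrightarrow> 0"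
  proof -
    obtain L where L: "(\<lambda>k. (norm (s k - z))\<^sup>2) \<longlonglongrightarrow> L" using conv[OF z] by blast
    define h where "h k = ((norm (s k - z))\<^sup>2 - (norm (s (Suc k) - z))\<^sup>2) / \<kappa>" for k
    have "(norm (s k - T (s k)))\<^sup>2 \<le> h k" for k
    proof -
      have "(norm (s k - T (s k)))\<^sup>2 * \<kappa> \<le> (norm (s k - z))\<^sup>2 - (norm (s (Suc k) - z))\<^sup>2"
        using step[OF z, of k] by (simp add: mult.commute[of _ \<kappa>])
      then show ?thesis unfolding h_def using \<kappa> by (simp only: pos_le_divide_eq)
    qed
    moreover have "h \<longlonglongrightarrow> 0"
      unfolding h_def using tendsto_divide[OF tendsto_diff[OF L LIMSEQ_Suc[OF L]] tendsto_const, of \<kappa>] \<kappa>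
      by simp
    ultimately have "(\<lambda>k. (norm (s k - T (s k)))\<^sup>2) \<longlonglongrightarrow> 0"
      using real_tendsto_sandwich[of "\<lambda>_. 0" "\<lambda>k. (norm (s k - T (s k)))\<^sup>2" sequentially h 0] by simp
    then have "(\<lambda>k. sqrt ((norm (s k - T (s k)))\<^sup>2)) \<longlonglongrightarrow> sqrt 0" by (rule tendsto_real_sqrt)
    then show ?thesis by (simp add: tendsto_norm_zero_iff)
  qed
  obtain c where c: "\<And>u. asymptotic_sqradius sequentially s u \<le> asymptotic_sqradius sequentially s c \<Longrightarrow> u = c"
    "\<And>u. asymptotic_sqradius sequentially s c \<le> asymptotic_sqradius sequentially s u"
    using ex_asymptotic_center[OF sequentially_bot bdd] by blast
  have Tc: "T c = c" by (rule asymptotic_center_fixed[OF sequentially_bot bdd nonexp reg c(1)])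
  have same: "c' = c"
    if F: "F \<noteq> bot" "F \<le> sequentially"
      and c'1: "\<And>u. asymptotic_sqradius F s u \<le> asymptotic_sqradius F s c' \<Longrightarrow> u = c'"
      and c'2: "\<And>u. asymptotic_sqradius F s c' \<le> asymptotic_sqradius F s u" for F c'
  proof -
    have Tc': "T c' = c'"
      by (rule asymptotic_center_fixed[OF F(1) bdd nonexp tendsto_mono[OF F(2) reg] c'1])
    have eq: "asymptotic_sqradius F s w = asymptotic_sqradius sequentially s w" if w: "T w = w" for w
    proof -
      obtain L where L: "(\<lambda>k. (norm (s k - w))\<^sup>2) \<longlonglongrightarrow> L" using conv[OF w] by blast
      show ?thesis
        using asymptotic_sqradius_eq_lim[OF F(1) bdd tendsto_mono[OF F(2) L]]
          asymptotic_sqradius_eq_lim[OF sequentially_bot bdd L] by simp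
    qed
    show ?thesis using c(1)[of c'] c'2[of c] eq[OF Tc] eq[OF Tc'] by simp
  qed
  have upper: "eventually (\<lambda>k. inner (s k - c) u < e) sequentially" if e: "e > 0" for u e
  proof (rule ccontr)
    assume not: "\<not> ?thesis"
    \<comment> \<open>The filter that plays the role of a subsequence on which the inner product stays large.\<close>
    define F where "F = inf sequentially (principal {k. e \<le> inner (s k - c) u})"
    have F: "F \<noteq> bot" "F \<le> sequentially"
      using not unfolding F_def trivial_limit_def eventually_inf_principal
      by (auto simp: not_le)
    have evF: "eventually (\<lambda>k. e \<le> inner (s k - c) u) F"
      unfolding F_def eventually_inf_principal by simp
    obtain c' where c': "\<And>u. asymptotic_sqradius F s u \<le> asymptotic_sqradius F s c' \<Longrightarrow> u = c'"
      "\<And>u. asymptotic_sqradius F s c' \<le> asymptotic_sqradius F s u"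
      using ex_asymptotic_center[OF F(1) bdd] by blast
    have cF: "w = c" if "asymptotic_sqradius F s w \<le> asymptotic_sqradius F s c" for w
      using same[OF F c'] c'(1) that by blast
    have u0: "u \<noteq> 0" using not e by auto
    \<comment> \<open>The minimizer of the quadratic upper bound \<open>- 2 * t * e + (t * norm u)\<^sup>2\<close> for the change of
      the squared distance.\<close>
    define t where "t = e / (norm u)\<^sup>2"
    have t: "t > 0" using e u0 by (simp add: t_def)
    have tn: "t * (norm u)\<^sup>2 = e" using u0 by (simp add: t_def)
    have "eventually (\<lambda>k. (norm (s k - (c + t *\<^sub>R u)))\<^sup>2 \<le> (norm (s k - c))\<^sup>2 + 0) F"
      using evF
    proof eventually_elim
      case (elim k)
      have "(norm (s k - (c + t *\<^sub>R u)))\<^sup>2 = (norm ((s k - c) - t *\<^sub>R u))\<^sup>2" by (simp add: algebra_simps)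
      also have "\<dots> = (norm (s k - c))\<^sup>2 - 2 * t * inner (s k - c) u + t * (t * (norm u)\<^sup>2)"
        unfolding power2_norm_eq_inner
        by (simp add: inner_diff_left[of "s k - c"] inner_diff_right[of _ "s k - c"]
            inner_commute[of u "s k - c"] right_diff_distrib)
      also have "\<dots> \<le> (norm (s k - c))\<^sup>2 - 2 * t * e + t * e"
        using elim t by (simp add: tn)
      also have "\<dots> = (norm (s k - c))\<^sup>2 - t * e" by simp
      also have "\<dots> \<le> (norm (s k - c))\<^sup>2 + 0" using t e by simp
      finally show ?case .
    qed
    then have "asymptotic_sqradius F s (c + t *\<^sub>R u) \<le> asymptotic_sqradius F s c + 0"
      by (rule asymptotic_sqradius_perturb[OF F(1) bdd _ tendsto_const])
    then have "c + t *\<^sub>R u = c" by (intro cF) simp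
    then show False using t u0 by simp
  qed
  have "(\<lambda>k. inner (s k) u) \<longlonglongrightarrow> inner c u" for u
  proof (rule tendstoI)
    fix e :: real assume e: "e > 0"
    from upper[OF e, of u] upper[OF e, of "- u"]
    show "eventually (\<lambda>k. dist (inner (s k) u) (inner c u) < e) sequentially"
      by eventually_elim (auto simp: dist_real_def inner_diff_left)
  qed
  then have "weakly_converges s c" unfolding weakly_converges_def by blast
  with Tc show thesis by (rule that)
qed

section \<open>The generalized Douglas--Rachford iteration\<close>

lemma gen_DR_fixed_iff:
  fixes f g :: "'a::{real_inner, complete_space} \<Rightarrow> ereal"
  assumes g: "g \<in> Gamma0"
  shows "gen_DR f g x y = y \<longleftrightarrow> y \<in> fprox f g x"
proof -
  have "gen_DR f g x y = y \<longleftrightarrow> prox g (x + prox f y - y) = prox f y"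
    unfolding gen_DR_def by (auto simp: algebra_simps)
  also have "\<dots> \<longleftrightarrow> x - y \<in> subdiff g (prox f y)"
    using prox_mem[OF g, of "x + prox f y - y"] prox_eqI[of g "x + prox f y - y" "prox f y"] g
    unfolding Gamma0_def by auto
  also have "\<dots> \<longleftrightarrow> y \<in> fprox f g x"
    unfolding fprox_def by (simp add: mem_resolvent_iff[where A = "\<lambda>u. subdiff g (prox f u)"])
  finally show ?thesis .
qed

lemma gen_DR_averaged:
  fixes f g :: "'a::{real_inner, complete_space} \<Rightarrow> ereal"
  assumes f: "f \<in> Gamma0" and g: "g \<in> Gamma0"
  shows "(norm (gen_DR f g x u - gen_DR f g x v))\<^sup>2
      + (1/2) * (norm ((u - gen_DR f g x u) - (v - gen_DR f g x v)))\<^sup>2 \<le> (norm (u - v))\<^sup>2"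
proof -
  define Q where "Q u = u - prox f u" for u
  define S where "S q = x - ((x - q) - prox g (x - q))" for q
  have "firmly_nonexpansive Q"
    unfolding Q_def by (intro firmly_nonexpansive_complement firmly_nonexpansive_prox f)
  moreover have "firmly_nonexpansive S"
    unfolding S_def
    by (rule firmly_nonexpansive_reflect[OF firmly_nonexpansive_complement[OF firmly_nonexpansive_prox[OF g]]])
  moreover have "gen_DR f g x w = S (Q w)" for w
    unfolding gen_DR_def S_def Q_def by (simp add: algebra_simps)
  ultimately show ?thesis using firmly_nonexpansive_compose[of S Q u v] by simp
qed

lemma prox_sum_eq:
  fixes f g :: "'a::{real_inner, complete_space} \<Rightarrow> ereal"
  assumes f: "f \<in> Gamma0" and g: "g \<in> Gamma0"
    and dom: "edom f \<inter> edom g \<noteq> {}"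
    and sum: "\<And>u. subdiff f u + subdiff g u \<subseteq> subdiff (\<lambda>v. f v + g v) u"
    and y: "y \<in> fprox f g x"
  shows "prox f y = prox (\<lambda>v. f v + g v) x"
proof -
  have pf: "proper f" and pg: "proper g" using f g unfolding Gamma0_def by blast+
  have "f v + g v \<noteq> - \<infinity>" for v using pf pg unfolding proper_def by auto
  moreover have "edom f \<inter> edom g \<subseteq> edom (\<lambda>v. f v + g v)"
    unfolding edom_def by auto
  ultimately have "proper (\<lambda>v. f v + g v)" using dom unfolding proper_def by auto
  moreover have "x - y \<in> subdiff g (prox f y)"
    using y unfolding fprox_def
    by (simp add: mem_resolvent_iff[where A = "\<lambda>u. subdiff g (prox f u)"])
  then have "(y - prox f y) + (x - y) \<in> subdiff f (prox f y) + subdiff g (prox f y)"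
    by (rule set_plus_intro[OF prox_mem[OF f]])
  then have "x - prox f y \<in> subdiff (\<lambda>v. f v + g v) (prox f y)"
    using sum[of "prox f y"] by (auto simp: algebra_simps)
  ultimately show ?thesis by (rule prox_eqI[symmetric])
qed

theorem theorem3p3:
  fixes f g :: "'a::{real_inner, complete_space} \<Rightarrow> ereal"
    and x y0 :: 'a
    and y :: "nat \<Rightarrow> 'a"
  assumes "f \<in> Gamma0" and "g \<in> Gamma0"
    and "x \<in> svm_domain (fprox f g)"
    and "y 0 = y0"
    and "\<And>k. y (Suc k) = gen_DR f g x (y k)"
  shows "\<exists>ystar. ystar \<in> fprox f g x \<and> weakly_converges y ystar \<and>
    (edom f \<inter> edom g \<noteq> {} \<and>
     (\<forall>u. subdiff (\<lambda>v. f v + g v) u = subdiff f u + subdiff g u)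
     \<longrightarrow> prox f ystar = prox (\<lambda>v. f v + g v) x)"
proof -
  obtain z where "z \<in> fprox f g x" using assms(3) unfolding svm_domain_def by blast
  then have z: "gen_DR f g x z = z" using gen_DR_fixed_iff[OF assms(2)] by blast
  have half: "(0::real) < 1/2" by simp
  obtain c where "gen_DR f g x c = c" "weakly_converges y c"
    using averaged_iterates_weakly_converge[of "1/2" "gen_DR f g x" z y,
        OF half gen_DR_averaged[OF assms(1,2)] z assms(5)] by blast
  then show ?thesis
    using gen_DR_fixed_iff[OF assms(2)] prox_sum_eq[OF assms(1,2), of c x] by (metis order_refl)
qed

end
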